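(* Let $(M,\varphi,\xi,\eta,g)$ be a para-Sasakian manifold of dimension $n>2$ with constant scalar curvature $r$ and vanishing $D$-concircular tensor field. Then $(M,g,\xi)$ is a manifold of quasi-constant curvature $M^n_{a,b}(\xi)$ with $$a=\frac{r+2(n-1)}{(n-1)(n-2)},\qquad b=\frac{-r-n(n-1)}{(n-1)(n-2)},$$ and any Ricci soliton of the form $(g,\xi,\lambda)$ on $M$ is expanding, i.e. $\lambda>0$.
   Context: A para-Sasakian manifold is a Riemannian manifold $(M,g)$ with a $(1,1)$-tensor field $\varphi$, a vector field $\xi$ and a $1$-form $\eta$ satisfying $\varphi^2X=X-\eta(X)\xi$, $\eta(\xi)=1$, $\eta(X)=g(X,\xi)$, $g(\varphi X,\varphi Y)=g(X,Y)-\eta(X)\eta(Y)$, $d\eta=0$, $\nabla_X\xi=\varphi X$ and $(\nabla_X\varphi)Y=-g(X,Y)\xi-\eta(Y)X+2\eta(X)\eta(Y)\xi$, where $\nabla$ is the Levi-Civita connection. With $r$ the scalar curvature, and $a=\frac{r+2(n-1)}{(n-1)(n-2)}$, $b=\frac{-r-n(n-1)}{(n-1)(n-2)}$, the $D$-concircular tensor field is (up to sign convention) the tensor $$V(X,Y)Z=R(X,Y)Z-a[g(Y,Z)X-g(X,Z)Y]-b[g(Y,Z)\eta(X)-g(X,Z)\eta(Y)]\xi-b\,\eta(Z)[\eta(Y)X-\eta(X)Y].$$ A triple $(M,g,\xi)$, with $\xi$ a unit vector field and $\eta$ its $g$-dual $1$-form, is a manifold of quasi-constant curvature $M^n_{a,b}(\xi)$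 (with $a,b\in C^\infty(M)$) if $$R(X,Y)Z=a[g(Y,Z)X-g(X,Z)Y]+b[g(Y,Z)\eta(X)-g(X,Z)\eta(Y)]\xi+b\,\eta(Z)[\eta(Y)X-\eta(X)Y]$$ for all vector fields $X,Y,Z$. The Ricci tensor is $S(X,Y)=\mathrm{Tr}(Z\mapsto R(Z,X)Y)$. A Ricci soliton is a triple $(g,V,\lambda)$ with $V$ a vector field and $\lambda$ a real constant such that $\mathcal{L}_Vg+2S+2\lambda g=0$; it is shrinking, steady or expanding according as $\lambda$ is negative, zero or positive. *)

theory Defs
  imports "HOL-Analysis.Analysis" "HOL-Library.Function_Algebras"
begin

section \<open>Pointwise vector space structure on functions\<close>

instantiation "fun" :: (type, scaleR) scaleR
begin
definition scaleR_fun :: "real \<Rightarrow> ('a \<Rightarrow> 'b) \<Rightarrow> 'a \<Rightarrow> 'b" where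
  "scaleR_fun r f = (\<lambda>x. r *\<^sub>R f x)"
instance ..
end

instance "fun" :: (type, real_vector) real_vector
  by standard (auto simp: scaleR_fun_def fun_eq_iff scaleR_add_right scaleR_add_left)


section \<open>Smooth maps between Euclidean spaces\<close>

text \<open>Used for open \<open>S\<close> only. A map is \<open>C\<^sup>k\<^sup>+\<^sup>1\<close> if it is differentiable and its partial
  derivatives are \<open>C\<^sup>k\<close>.\<close>

primrec Ck_on :: "nat \<Rightarrow> 'a::euclidean_space set \<Rightarrow> ('a \<Rightarrow> 'b::real_normed_vector) \<Rightarrow> bool" where
  "Ck_on 0 S f \<longleftrightarrow> continuous_on S f"
| "Ck_on (Suc k) S f \<longleftrightarrow> (\<forall>x\<in>S. f differentiable (at x)) \<and>
     (\<forall>e\<in>Basis. Ck_on k S (\<lambda>x. frechet_derivative f (at x) e))"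

definition smooth_on :: "'a::euclidean_space set \<Rightarrow> ('a \<Rightarrow> 'b::real_normed_vector) \<Rightarrow> bool" where
  "smooth_on S f \<longleftrightarrow> (\<forall>k. Ck_on k S f)"


section \<open>Smooth manifolds of dimension \<open>CARD('n)\<close>\<close>

text \<open>A chart is a pair of its domain and its coordinate map; the values of the coordinate map
  outside the domain are irrelevant.\<close>

type_synonym ('m, 'n) chart = "'m set \<times> ('m \<Rightarrow> real ^ 'n)"

abbreviation dom_of :: "('m, 'n) chart \<Rightarrow> 'm set" where
  "dom_of c \<equiv> fst c"

abbreviation coord :: "('m, 'n) chart \<Rightarrow> 'm \<Rightarrow> real ^ 'n" where
  "coord c \<equiv> snd c"

definition coord_inv :: "('m, 'n) chart \<Rightarrow> real ^ 'n \<Rightarrow> 'm" where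
  "coord_inv c = inv_into (dom_of c) (coord c)"

definition is_chart :: "'m topology \<Rightarrow> ('m, 'n::finite) chart \<Rightarrow> bool" where
  "is_chart T c \<longleftrightarrow> openin T (dom_of c) \<and> open (coord c ` dom_of c) \<and>
     homeomorphic_map (subtopology T (dom_of c)) (top_of_set (coord c ` dom_of c)) (coord c)"

text \<open>The atlas \<open>A\<close> need not be maximal.\<close>

definition smooth_manifold :: "'m topology \<Rightarrow> ('m, 'n::finite) chart set \<Rightarrow> bool" where
  "smooth_manifold T A \<longleftrightarrow>
     topspace T \<noteq> {} \<and> Hausdorff_space T \<and> second_countable T \<and>
     (\<forall>c\<in>A. is_chart T c) \<and> (\<Union>c\<in>A. dom_of c) = topspace T \<and>
     (\<forall>c\<in>A. \<forall>d\<in>A. smooth_on (coord c ` (dom_of c \<inter> dom_of d)) (coord d \<circ> coord_inv c))"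

definition points :: "('m, 'n) chart set \<Rightarrow> 'm set" where
  "points A = (\<Union>c\<in>A. dom_of c)"

definition charts_at :: "('m, 'n) chart set \<Rightarrow> 'm \<Rightarrow> ('m, 'n) chart set" where
  "charts_at A p = {c \<in> A. p \<in> dom_of c}"

definition smooth_functions :: "('m, 'n::finite) chart set \<Rightarrow> ('m \<Rightarrow> real) set" where
  "smooth_functions A = {f. \<forall>c\<in>A. smooth_on (coord c ` dom_of c) (f \<circ> coord_inv c)}"


section \<open>Tangent vectors and vector fields\<close>

text \<open>A tangent vector at \<open>p\<close> assigns to every chart around \<open>p\<close> a column of components, and these
  columns are related by the Jacobian matrices of the chart changes. The value at all other
  charts is \<open>0\<close>, so that equality of tangent vectors is equality of functions; in particular the
  tangent space at a point outside the manifold is \<open>{0}\<close>.\<close>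

type_synonym ('m, 'n) tangent = "('m, 'n) chart \<Rightarrow> real ^ 'n"
type_synonym ('m, 'n) field = "'m \<Rightarrow> ('m, 'n) tangent"

definition tangent_space :: "('m, 'n::finite) chart set \<Rightarrow> 'm \<Rightarrow> ('m, 'n) tangent set" where
  "tangent_space A p = {v.
     (\<forall>c. c \<notin> charts_at A p \<longrightarrow> v c = 0) \<and>
     (\<forall>c\<in>charts_at A p. \<forall>d\<in>charts_at A p.
        v d = frechet_derivative (coord d \<circ> coord_inv c) (at (coord c p)) (v c))}"

definition vector_fields :: "('m, 'n::finite) chart set \<Rightarrow> ('m, 'n) field set" where
  "vector_fields A = {X. (\<forall>p. X p \<in> tangent_space A p) \<and>
     (\<forall>c\<in>A. smooth_on (coord c ` dom_of c) (\<lambda>x. X (coord_inv c x) c))}"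

text \<open>\<open>X f\<close>, computed in a chart; the choice of the chart does not matter.\<close>

definition dir_deriv ::
  "('m, 'n::finite) chart set \<Rightarrow> ('m, 'n) field \<Rightarrow> ('m \<Rightarrow> real) \<Rightarrow> 'm \<Rightarrow> real" where
  "dir_deriv A X f p =
     (let c = (SOME c. c \<in> charts_at A p)
      in frechet_derivative (f \<circ> coord_inv c) (at (coord c p)) (X p c))"

text \<open>The Lie bracket, with components
  \<open>[X,Y]\<^sup>k = X\<^sup>i \<partial>\<^sub>i Y\<^sup>k - Y\<^sup>i \<partial>\<^sub>i X\<^sup>k\<close> in every chart.\<close>

definition bracket ::
  "('m, 'n::finite) chart set \<Rightarrow> ('m, 'n) field \<Rightarrow> ('m, 'n) field \<Rightarrow> ('m, 'n) field" where
  "bracket A X Y = (\<lambda>p c. if c \<in> charts_at A p then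
       frechet_derivative (\<lambda>x. Y (coord_inv c x) c) (at (coord c p)) (X p c)
     - frechet_derivative (\<lambda>x. X (coord_inv c x) c) (at (coord c p)) (Y p c) else 0)"

abbreviation fmult :: "('m \<Rightarrow> real) \<Rightarrow> ('m, 'n::finite) field \<Rightarrow> ('m, 'n) field" where
  "fmult f X \<equiv> (\<lambda>p. f p *\<^sub>R X p)"


section \<open>Tensor fields\<close>

definition linear_map_on :: "'a::real_vector set \<Rightarrow> ('a \<Rightarrow> 'b::real_vector) \<Rightarrow> bool" where
  "linear_map_on V F \<longleftrightarrow> (\<forall>u\<in>V. \<forall>v\<in>V. F (u + v) = F u + F v) \<and>
     (\<forall>s. \<forall>u\<in>V. F (s *\<^sub>R u) = s *\<^sub>R F u)"

definition one_form ::
  "('m, 'n::finite) chart set \<Rightarrow> ('m \<Rightarrow> ('m, 'n) tangent \<Rightarrow> real) \<Rightarrow> bool" where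
  "one_form A \<eta> \<longleftrightarrow> (\<forall>p. linear_map_on (tangent_space A p) (\<eta> p)) \<and>
     (\<forall>X\<in>vector_fields A. (\<lambda>p. \<eta> p (X p)) \<in> smooth_functions A)"

definition tensor_1_1 ::
  "('m, 'n::finite) chart set \<Rightarrow> ('m \<Rightarrow> ('m, 'n) tangent \<Rightarrow> ('m, 'n) tangent) \<Rightarrow> bool" where
  "tensor_1_1 A \<phi> \<longleftrightarrow> (\<forall>p. linear_map_on (tangent_space A p) (\<phi> p)) \<and>
     (\<forall>X\<in>vector_fields A. (\<lambda>p. \<phi> p (X p)) \<in> vector_fields A)"

text \<open>The exterior derivative of a one-form, without the factor \<open>1/2\<close> used by some authors.\<close>

definition ext_deriv :: "('m, 'n::finite) chart set \<Rightarrow> ('m \<Rightarrow> ('m, 'n) tangent \<Rightarrow> real) \<Rightarrow>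
    ('m, 'n) field \<Rightarrow> ('m, 'n) field \<Rightarrow> 'm \<Rightarrow> real" where
  "ext_deriv A \<eta> X Y p = dir_deriv A X (\<lambda>q. \<eta> q (Y q)) p - dir_deriv A Y (\<lambda>q. \<eta> q (X q)) p
     - \<eta> p (bracket A X Y p)"


section \<open>Riemannian metrics and the Levi-Civita connection\<close>

type_synonym ('m, 'n) metric = "'m \<Rightarrow> ('m, 'n) tangent \<Rightarrow> ('m, 'n) tangent \<Rightarrow> real"
type_synonym ('m, 'n) conn = "('m, 'n) field \<Rightarrow> ('m, 'n) field \<Rightarrow> ('m, 'n) field"

definition riemannian_metric ::
  "('m, 'n::finite) chart set \<Rightarrow> ('m, 'n) metric \<Rightarrow> bool" where
  "riemannian_metric A g \<longleftrightarrow>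
     (\<forall>p\<in>points A.
        (\<forall>u\<in>tangent_space A p. linear_map_on (tangent_space A p) (g p u)) \<and>
        (\<forall>u\<in>tangent_space A p. \<forall>v\<in>tangent_space A p. g p u v = g p v u) \<and>
        (\<forall>u\<in>tangent_space A p. u \<noteq> 0 \<longrightarrow> g p u u > 0)) \<and>
     (\<forall>X\<in>vector_fields A. \<forall>Y\<in>vector_fields A. (\<lambda>p. g p (X p) (Y p)) \<in> smooth_functions A)"

definition affine_connection :: "('m, 'n::finite) chart set \<Rightarrow> ('m, 'n) conn \<Rightarrow> bool" where
  "affine_connection A D \<longleftrightarrow>
     (\<forall>X\<in>vector_fields A. \<forall>Y\<in>vector_fields A. D X Y \<in> vector_fields A) \<and>
     (\<forall>X\<in>vector_fields A. \<forall>X'\<in>vector_fields A. \<forall>Y\<in>vector_fields A.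
        D (X + X') Y = D X Y + D X' Y \<and> D Y (X + X') = D Y X + D Y X') \<and>
     (\<forall>f\<in>smooth_functions A. \<forall>X\<in>vector_fields A. \<forall>Y\<in>vector_fields A.
        D (fmult f X) Y = fmult f (D X Y) \<and>
        D X (fmult f Y) = fmult (dir_deriv A X f) Y + fmult f (D X Y))"

definition levi_civita ::
  "('m, 'n::finite) chart set \<Rightarrow> ('m, 'n) metric \<Rightarrow> ('m, 'n) conn \<Rightarrow> bool" where
  "levi_civita A g D \<longleftrightarrow> affine_connection A D \<and>
     (\<forall>X\<in>vector_fields A. \<forall>Y\<in>vector_fields A. D X Y - D Y X = bracket A X Y) \<and>
     (\<forall>X\<in>vector_fields A. \<forall>Y\<in>vector_fields A. \<forall>Z\<in>vector_fields A. \<forall>p\<in>points A.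
        dir_deriv A X (\<lambda>q. g q (Y q) (Z q)) p = g p (D X Y p) (Z p) + g p (Y p) (D X Z p))"

text \<open>The Levi-Civita connection \<open>D\<close> is determined by \<open>g\<close> on \<open>vector_fields A\<close>;
  its values elsewhere are never used.\<close>

definition riemannian_manifold :: "'m topology \<Rightarrow> ('m, 'n::finite) chart set \<Rightarrow>
    ('m, 'n) metric \<Rightarrow> ('m, 'n) conn \<Rightarrow> bool" where
  "riemannian_manifold T A g D \<longleftrightarrow>
     smooth_manifold T A \<and> riemannian_metric A g \<and> levi_civita A g D"


section \<open>Curvature\<close>

definition curvature :: "('m, 'n::finite) chart set \<Rightarrow> ('m, 'n) conn \<Rightarrow>
    ('m, 'n) field \<Rightarrow> ('m, 'n) field \<Rightarrow> ('m, 'n) field \<Rightarrow> ('m, 'n) field" where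
  "curvature A D X Y Z = D X (D Y Z) - D Y (D X Z) - D (bracket A X Y) Z"

text \<open>The value of the curvature tensor on tangent vectors at \<open>p\<close>: extend them to vector fields
  on the whole manifold. By tensoriality the result does not depend on the extensions.\<close>

definition extension ::
  "('m, 'n::finite) chart set \<Rightarrow> 'm \<Rightarrow> ('m, 'n) tangent \<Rightarrow> ('m, 'n) field" where
  "extension A p v = (SOME X. X \<in> vector_fields A \<and> X p = v)"

definition curvature_at :: "('m, 'n::finite) chart set \<Rightarrow> ('m, 'n) conn \<Rightarrow> 'm \<Rightarrow>
    ('m, 'n) tangent \<Rightarrow> ('m, 'n) tangent \<Rightarrow> ('m, 'n) tangent \<Rightarrow> ('m, 'n) tangent" where
  "curvature_at A D p u v w =
     curvature A D (extension A p u) (extension A p v) (extension A p w) p"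

text \<open>Trace of an endomorphism \<open>F\<close> of a finite-dimensional subspace \<open>V\<close>, in any basis of \<open>V\<close>.\<close>

definition trace_on :: "'a::real_vector set \<Rightarrow> ('a \<Rightarrow> 'a) \<Rightarrow> real" where
  "trace_on V F = (let B = (SOME B. independent B \<and> span B = V)
                   in \<Sum>b\<in>B. representation B (F b) b)"

definition ricci :: "('m, 'n::finite) chart set \<Rightarrow> ('m, 'n) conn \<Rightarrow> ('m, 'n) metric" where
  "ricci A D p u v = trace_on (tangent_space A p) (\<lambda>z. curvature_at A D p z u v)"

text \<open>The trace of the Ricci tensor with respect to \<open>g\<close>, in any orthonormal basis.\<close>

definition scalar_curvature ::
  "('m, 'n::finite) chart set \<Rightarrow> ('m, 'n) metric \<Rightarrow> ('m, 'n) conn \<Rightarrow> 'm \<Rightarrow> real" where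
  "scalar_curvature A g D p =
     (let B = (SOME B. finite B \<and> span B = tangent_space A p \<and>
                 (\<forall>u\<in>B. \<forall>v\<in>B. g p u v = (if u = v then 1 else 0)))
      in \<Sum>e\<in>B. ricci A D p e e)"


section \<open>Para-Sasakian manifolds, quasi-constant curvature, Ricci solitons\<close>

definition para_sasakian :: "'m topology \<Rightarrow> ('m, 'n::finite) chart set \<Rightarrow>
    ('m \<Rightarrow> ('m, 'n) tangent \<Rightarrow> ('m, 'n) tangent) \<Rightarrow> ('m, 'n) field \<Rightarrow>
    ('m \<Rightarrow> ('m, 'n) tangent \<Rightarrow> real) \<Rightarrow> ('m, 'n) metric \<Rightarrow> ('m, 'n) conn \<Rightarrow> bool" where
  "para_sasakian T A \<phi> \<xi> \<eta> g D \<longleftrightarrow>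
     riemannian_manifold T A g D \<and>
     tensor_1_1 A \<phi> \<and> \<xi> \<in> vector_fields A \<and> one_form A \<eta> \<and>
     (\<forall>p\<in>points A. \<eta> p (\<xi> p) = 1) \<and>
     (\<forall>X\<in>vector_fields A. \<forall>p\<in>points A.
        \<phi> p (\<phi> p (X p)) = X p - \<eta> p (X p) *\<^sub>R \<xi> p \<and>
        \<eta> p (X p) = g p (X p) (\<xi> p) \<and>
        D X \<xi> p = \<phi> p (X p)) \<and>
     (\<forall>X\<in>vector_fields A. \<forall>Y\<in>vector_fields A. \<forall>p\<in>points A.
        g p (\<phi> p (X p)) (\<phi> p (Y p)) = g p (X p) (Y p) - \<eta> p (X p) * \<eta> p (Y p) \<and>
        ext_deriv A \<eta> X Y p = 0 \<and>
        D X (\<lambda>q. \<phi> q (Y q)) p - \<phi> p (D X Y p) =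
          - (g p (X p) (Y p) *\<^sub>R \<xi> p) - \<eta> p (Y p) *\<^sub>R X p
          + (2 * \<eta> p (X p) * \<eta> p (Y p)) *\<^sub>R \<xi> p)"

text \<open>The right-hand side of the quasi-constant curvature condition.\<close>

definition quasi_constant_tensor ::
  "('m, 'n) metric \<Rightarrow> ('m, 'n) field \<Rightarrow> ('m \<Rightarrow> ('m, 'n) tangent \<Rightarrow> real) \<Rightarrow>
   ('m \<Rightarrow> real) \<Rightarrow> ('m \<Rightarrow> real) \<Rightarrow>
   ('m, 'n) field \<Rightarrow> ('m, 'n) field \<Rightarrow> ('m, 'n) field \<Rightarrow> ('m, 'n::finite) field" where
  "quasi_constant_tensor g \<xi> \<eta> a b X Y Z = (\<lambda>p.
       a p *\<^sub>R (g p (Y p) (Z p) *\<^sub>R X p - g p (X p) (Z p) *\<^sub>R Y p)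
     + b p *\<^sub>R ((g p (Y p) (Z p) * \<eta> p (X p) - g p (X p) (Z p) * \<eta> p (Y p)) *\<^sub>R \<xi> p)
     + (b p * \<eta> p (Z p)) *\<^sub>R (\<eta> p (Y p) *\<^sub>R X p - \<eta> p (X p) *\<^sub>R Y p))"

definition quasi_constant_curvature :: "'m topology \<Rightarrow> ('m, 'n::finite) chart set \<Rightarrow>
    ('m, 'n) metric \<Rightarrow> ('m, 'n) conn \<Rightarrow> ('m, 'n) field \<Rightarrow>
    ('m \<Rightarrow> real) \<Rightarrow> ('m \<Rightarrow> real) \<Rightarrow> bool" where
  "quasi_constant_curvature T A g D \<xi> a b \<longleftrightarrow>
     riemannian_manifold T A g D \<and>
     \<xi> \<in> vector_fields A \<and> (\<forall>p\<in>points A. g p (\<xi> p) (\<xi> p) = 1) \<and>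
     a \<in> smooth_functions A \<and> b \<in> smooth_functions A \<and>
     (\<forall>X\<in>vector_fields A. \<forall>Y\<in>vector_fields A. \<forall>Z\<in>vector_fields A. \<forall>p\<in>points A.
        curvature A D X Y Z p =
          quasi_constant_tensor g \<xi> (\<lambda>q v. g q v (\<xi> q)) a b X Y Z p)"

definition coeff_a :: "real \<Rightarrow> real \<Rightarrow> real" where
  "coeff_a n r = (r + 2 * (n - 1)) / ((n - 1) * (n - 2))"

definition coeff_b :: "real \<Rightarrow> real \<Rightarrow> real" where
  "coeff_b n r = (- r - n * (n - 1)) / ((n - 1) * (n - 2))"

definition D_concircular :: "('m, 'n::finite) chart set \<Rightarrow> ('m, 'n) metric \<Rightarrow>
    ('m, 'n) conn \<Rightarrow> ('m, 'n) field \<Rightarrow> ('m \<Rightarrow> ('m, 'n) tangent \<Rightarrow> real) \<Rightarrow>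
    ('m, 'n) field \<Rightarrow> ('m, 'n) field \<Rightarrow> ('m, 'n) field \<Rightarrow> ('m, 'n) field" where
  "D_concircular A g D \<xi> \<eta> X Y Z = curvature A D X Y Z -
     quasi_constant_tensor g \<xi> \<eta>
       (\<lambda>p. coeff_a (real CARD('n)) (scalar_curvature A g D p))
       (\<lambda>p. coeff_b (real CARD('n)) (scalar_curvature A g D p)) X Y Z"

definition lie_deriv_metric :: "('m, 'n::finite) chart set \<Rightarrow> ('m, 'n) metric \<Rightarrow>
    ('m, 'n) field \<Rightarrow> ('m, 'n) field \<Rightarrow> ('m, 'n) field \<Rightarrow> 'm \<Rightarrow> real" where
  "lie_deriv_metric A g V X Y p = dir_deriv A V (\<lambda>q. g q (X q) (Y q)) p
     - g p (bracket A V X p) (Y p) - g p (X p) (bracket A V Y p)"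

definition ricci_soliton :: "('m, 'n::finite) chart set \<Rightarrow> ('m, 'n) metric \<Rightarrow>
    ('m, 'n) conn \<Rightarrow> ('m, 'n) field \<Rightarrow> real \<Rightarrow> bool" where
  "ricci_soliton A g D V l \<longleftrightarrow> V \<in> vector_fields A \<and>
     (\<forall>X\<in>vector_fields A. \<forall>Y\<in>vector_fields A. \<forall>p\<in>points A.
        lie_deriv_metric A g V X Y p + 2 * ricci A D p (X p) (Y p)
          + 2 * l * g p (X p) (Y p) = 0)"

end

(* Evaluate the soliton equation at (xi, xi). The Lie derivative term vanishes because
   nabla_xi xi = phi xi = 0. The vanishing of the D-concircular tensor gives
   R(Z, xi) xi = (a + b)(Z - eta(Z) xi) with a + b = -1, so S(xi, xi) = 1 - n and
   lambda = n - 1. Since the Ricci tensor is defined by extending tangent vectors to global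
   vector fields, the existence of such extensions (via a bump function) is also needed. *)

theory Submission
  imports Defs
begin

text \<open>The curvature at \<open>p\<close> is computed from fields picked by
  \<open>extension\<close>. The concircular identity holds for all global fields and its
  quasi-constant side depends only on their values at \<open>p\<close>, so it can be applied
  directly to the picked fields. Most of the work is to show that such fields exist:
  \<open>smooth_on\<close> rests on a recursion over \<open>frechet_derivative\<close>, so products,
  composites and the cut-off function are shown C^k by induction, and the field must be checked in
  every chart, not only in the one where it is built. The trace is also taken in a chosen basis, so
  the tangent space must be shown to have dimension n.\<close>

section \<open>Calculus of smooth maps\<close>

text \<open>A derivative at \<open>x\<close> sees only the values near \<open>x\<close>. As
  \<open>S\<close> is open, agreement on \<open>S\<close> passes to the partial derivatives,
  whatever the maps do outside \<open>S\<close>.\<close>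

lemma Ck_on_cong:
  fixes f g :: "'a::euclidean_space \<Rightarrow> 'b::real_normed_vector"
  assumes "open S"
  shows "(\<And>x. x \<in> S \<Longrightarrow> f x = g x) \<Longrightarrow> Ck_on k S f \<Longrightarrow> Ck_on k S g"
proof (induction k arbitrary: f g)
  case 0
  then show ?case using continuous_on_cong[of S S f g] by simp
next
  case (Suc k)
  have d: "(g has_derivative frechet_derivative f (at x)) (at x)" if x: "x \<in> S" for x
  proof (rule has_derivative_transform_within_open[OF _ assms x])
    show "(f has_derivative frechet_derivative f (at x)) (at x)"
      using Suc.prems(2) x frechet_derivative_works by auto
  qed (use Suc.prems in auto)
  have "Ck_on k S (\<lambda>x. frechet_derivative g (at x) e)" if "e \<in> Basis" for e
    by (rule Suc.IH[where f="\<lambda>x. frechet_derivative f (at x) e"])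
       (use Suc.prems(2) that frechet_derivative_at[OF d] in auto)
  then show ?case using d by (auto simp: differentiable_def)
qed

text \<open>Lets the derivative be an explicit formula instead of \<open>frechet_derivative\<close>;
  the inductive closure proofs below run through this rule.\<close>

lemma Ck_on_derivI:
  fixes f :: "'a::euclidean_space \<Rightarrow> 'b::real_normed_vector"
  assumes "open S" and d: "\<And>x. x \<in> S \<Longrightarrow> (f has_derivative f' x) (at x)"
    and k: "\<And>e. e \<in> Basis \<Longrightarrow> Ck_on k S (\<lambda>x. f' x e)"
  shows "Ck_on (Suc k) S f"
proof -
  have "Ck_on k S (\<lambda>x. frechet_derivative f (at x) e)" if "e \<in> Basis" for e
    by (rule Ck_on_cong[OF assms(1) _ k[OF that]]) (simp add: frechet_derivative_at[OF d, symmetric])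
  then show ?thesis using d by (auto simp: differentiable_def)
qed

lemma Ck_on_has_derivative:
  "Ck_on (Suc k) S f \<Longrightarrow> x \<in> S \<Longrightarrow> (f has_derivative frechet_derivative f (at x)) (at x)"
  using frechet_derivative_works by auto

text \<open>For maps given by different formulas on different open sets, such as a cut-off field
  inside and outside a chart.\<close>

lemma Ck_on_local:
  "(\<And>x. x \<in> S \<Longrightarrow> \<exists>N. open N \<and> x \<in> N \<and> Ck_on k N f) \<Longrightarrow> Ck_on k S f"
proof (induction k arbitrary: f)
  case 0
  have "isCont f x" if "x \<in> S" for x
    using 0[OF that] by (auto simp: continuous_on_eq_continuous_at)
  then show ?case
    by (simp add: continuous_at_imp_continuous_on)
next
  case (Suc k)
  have "Ck_on k S (\<lambda>x. frechet_derivative f (at x) e)" if "e \<in> Basis" for e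
    by (rule Suc.IH) (use Suc.prems that in fastforce)
  then show ?case using Suc.prems by fastforce
qed

text \<open>The product and chain rules leave undifferentiated factors beside the derivatives; the
  induction hypothesis needs these to be C^k too.\<close>

lemma Ck_on_SucD: "Ck_on (Suc k) S f \<Longrightarrow> Ck_on k S f"
proof (induction k arbitrary: f)
  case 0
  then show ?case
    by (auto intro!: continuous_at_imp_continuous_on differentiable_imp_continuous_within)
qed auto

lemma Ck_on_const: "open S \<Longrightarrow> Ck_on k S (\<lambda>x. c)"
proof (induction k arbitrary: c)
  case (Suc k)
  then show ?case by (intro Ck_on_derivI[where f'="\<lambda>_ _. 0"]) auto
qed auto

lemma Ck_on_add:
  "open S \<Longrightarrow> Ck_on k S f \<Longrightarrow> Ck_on k S g \<Longrightarrow> Ck_on k S (\<lambda>x. f x + g x)"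
proof (induction k arbitrary: f g)
  case 0
  then show ?case by (auto intro: continuous_intros)
next
  case (Suc k)
  show ?case
    by (rule Ck_on_derivI[OF Suc.prems(1) has_derivative_add[OF
          Ck_on_has_derivative[OF Suc.prems(2)] Ck_on_has_derivative[OF Suc.prems(3)]]])
       (use Suc in auto)
qed

lemma Ck_on_sum:
  "open S \<Longrightarrow> (\<And>i. i \<in> I \<Longrightarrow> Ck_on k S (f i)) \<Longrightarrow> Ck_on k S (\<lambda>x. \<Sum>i\<in>I. f i x)"
  by (induction I rule: infinite_finite_induct) (simp_all add: Ck_on_const Ck_on_add)

lemma Ck_on_bounded_linear:
  assumes "bounded_linear h" "open S"
  shows "Ck_on k S f \<Longrightarrow> Ck_on k S (\<lambda>x. h (f x))"
proof (induction k arbitrary: f)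
  case 0
  then show ?case by (auto intro: bounded_linear.continuous_on[OF assms(1)])
next
  case (Suc k)
  show ?case
    by (rule Ck_on_derivI[OF assms(2) bounded_linear.has_derivative[OF assms(1)
          Ck_on_has_derivative[OF Suc.prems]]]) (use Suc in auto)
qed

lemma Ck_on_scaleR:
  "open S \<Longrightarrow> Ck_on k S f \<Longrightarrow> Ck_on k S g \<Longrightarrow> Ck_on k S (\<lambda>x. f x *\<^sub>R g x)"
proof (induction k arbitrary: f g)
  case 0
  then show ?case by (auto intro: continuous_intros)
next
  case (Suc k)
  show ?case
  proof (rule Ck_on_derivI[OF Suc.prems(1) has_derivative_scaleR[OF
          Ck_on_has_derivative[OF Suc.prems(2)] Ck_on_has_derivative[OF Suc.prems(3)]]])
    fix e :: 'a assume "e \<in> Basis"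
    then show "Ck_on k S (\<lambda>x. f x *\<^sub>R frechet_derivative g (at x) e
        + frechet_derivative f (at x) e *\<^sub>R g x)"
      using Suc.prems Ck_on_SucD[OF Suc.prems(2)] Ck_on_SucD[OF Suc.prems(3)]
      by (intro Ck_on_add Suc.IH) auto
  qed
qed

lemma linear_expand_Basis:
  fixes h :: "'a::euclidean_space \<Rightarrow> 'b::real_vector"
  assumes "linear h"
  shows "h v = (\<Sum>i\<in>Basis. (v \<bullet> i) *\<^sub>R h i)"
proof -
  have "h (\<Sum>i\<in>Basis. (v \<bullet> i) *\<^sub>R i) = (\<Sum>i\<in>Basis. (v \<bullet> i) *\<^sub>R h i)"
    by (simp only: linear_sum[OF assms] linear_scale[OF assms])
  then show ?thesis by (simp only: euclidean_representation)
qed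

text \<open>\<open>Ck_on\<close> controls derivatives along fixed basis vectors, but the chain rule
  applies the derivative of \<open>g\<close> to the moving vector \<open>f'(x) e\<close>. Expanding
  that vector in the basis leaves sums of products. The induction varies \<open>g\<close> because
  its partial derivatives become the new outer maps.\<close>

lemma Ck_on_compose:
  fixes f :: "'a::euclidean_space \<Rightarrow> 'b::euclidean_space"
    and g :: "'b \<Rightarrow> 'c::real_normed_vector"
  assumes "open S" "f ` S \<subseteq> U"
  shows "Ck_on k S f \<Longrightarrow> Ck_on k U g \<Longrightarrow> Ck_on k S (\<lambda>x. g (f x))"
proof (induction k arbitrary: g)
  case 0
  then show ?case using assms by (auto intro: continuous_on_compose2)
next
  case (Suc k)
  have fU: "f x \<in> U" if "x \<in> S" for x using assms that by auto
  let ?F = "\<lambda>x. frechet_derivative f (at x)" and ?G = "\<lambda>y. frechet_derivative g (at y)"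
  show ?case
  proof (rule Ck_on_derivI[OF assms(1)])
    fix x assume x: "x \<in> S"
    have G: "(g has_derivative ?G (f x)) (at (f x))"
      using Ck_on_has_derivative[OF Suc.prems(2) fU[OF x]] .
    have "(\<lambda>e. ?G (f x) (?F x e)) = (\<lambda>e. \<Sum>i\<in>Basis. (?F x e \<bullet> i) *\<^sub>R ?G (f x) i)"
      by (intro ext linear_expand_Basis bounded_linear.linear has_derivative_bounded_linear[OF G])
    with has_derivative_compose[OF Ck_on_has_derivative[OF Suc.prems(1) x] G]
    show "((\<lambda>x. g (f x)) has_derivative
        (\<lambda>e. \<Sum>i\<in>Basis. (?F x e \<bullet> i) *\<^sub>R ?G (f x) i)) (at x)"
      by (rule has_derivative_eq_rhs)
  next
    fix e :: 'a assume e: "e \<in> Basis"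
    show "Ck_on k S (\<lambda>x. \<Sum>i\<in>Basis. (?F x e \<bullet> i) *\<^sub>R ?G (f x) i)"
    proof (intro Ck_on_sum Ck_on_scaleR assms(1))
      fix i :: 'b assume "i \<in> Basis"
      then show "Ck_on k S (\<lambda>x. ?G (f x) i)"
        using Suc.prems Ck_on_SucD[OF Suc.prems(1)] by (intro Suc.IH) auto
      show "Ck_on k S (\<lambda>x. ?F x e \<bullet> i)"
        using Suc.prems(1) e by (intro Ck_on_bounded_linear[OF bounded_linear_inner_left assms(1)]) auto
    qed
  qed
qed

lemma Ck_on_frechet_derivative:
  fixes f :: "'a::euclidean_space \<Rightarrow> 'b::real_normed_vector"
  assumes "open S" "Ck_on (Suc k) S f"
  shows "Ck_on k S (\<lambda>x. frechet_derivative f (at x) v)"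
proof (rule Ck_on_cong[OF assms(1)])
  show "Ck_on k S (\<lambda>x. \<Sum>i\<in>Basis. (v \<bullet> i) *\<^sub>R frechet_derivative f (at x) i)"
    using assms(2) by (intro Ck_on_sum Ck_on_scaleR Ck_on_const assms(1)) auto
  fix x assume "x \<in> S"
  then have "linear (frechet_derivative f (at x))"
    using assms(2) by (auto intro: linear_frechet_derivative)
  then show "(\<Sum>i\<in>Basis. (v \<bullet> i) *\<^sub>R frechet_derivative f (at x) i) = frechet_derivative f (at x) v"
    by (rule linear_expand_Basis[symmetric])
qed

section \<open>A bump function\<close>

text \<open>The functions \<open>exp (-1/t) / t\<^sup>m\<close>, extended by zero, are closed under differentiation up to
  linear combinations, which makes all of them smooth at once.\<close>

definition flat_exp :: "nat \<Rightarrow> real \<Rightarrow> real" where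
  "flat_exp m t = (if t > 0 then exp (- inverse t) * inverse t ^ m else 0)"

text \<open>With s = 1/t the right-hand limit becomes s^m / exp s as s tends to infinity.\<close>

lemma flat_exp_tendsto_0: "(flat_exp m \<longlongrightarrow> 0) (at 0)"
proof -
  have "((\<lambda>t::real. (inverse t) ^ m / exp (inverse t)) \<longlongrightarrow> 0) (at_right 0)"
    using filterlim_compose[OF tendsto_power_div_exp_0 filterlim_inverse_at_top_right] .
  moreover have "eventually (\<lambda>t::real. (inverse t) ^ m / exp (inverse t) = flat_exp m t) (at_right 0)"
    using eventually_at_right_less[of 0]
    by eventually_elim (simp add: flat_exp_def exp_minus field_simps)
  ultimately have r: "(flat_exp m \<longlongrightarrow> 0) (at_right 0)"
    by (rule Lim_transform_eventually)
  have "eventually (\<lambda>t::real. 0 = flat_exp m t) (at_left 0)"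
    by (auto simp: eventually_at_filter flat_exp_def)
  then have "(flat_exp m \<longlongrightarrow> 0) (at_left 0)"
    using Lim_transform_eventually tendsto_const by blast
  with r show ?thesis by (simp add: filterlim_at_split)
qed

lemma flat_exp_deriv:
  "(flat_exp m has_real_derivative flat_exp (m + 2) t - real m * flat_exp (m + 1) t) (at t)"
proof -
  consider "t > 0" | "t < 0" | "t = 0" by linarith
  then show ?thesis
  proof cases
    case 1
    have p: "((\<lambda>t. inverse t ^ m) has_real_derivative - real m * inverse t ^ (m + 1)) (at t)"
      using DERIV_power[OF DERIV_inverse[of t UNIV], of m] 1
      \<comment> \<open>\<open>DERIV_power\<close> carries the truncated exponent m - 1, so m = 0 is
        separated.\<close>
      by (cases m) (simp_all add: algebra_simps)
    have e: "((\<lambda>t. exp (- inverse t)) has_real_derivative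
        exp (- inverse t) * (inverse t * inverse t)) (at t)"
      using 1 by (auto intro!: derivative_eq_intros)
    have "((\<lambda>t. exp (- inverse t) * inverse t ^ m) has_real_derivative
        exp (- inverse t) * inverse t ^ (m + 2) - real m * (exp (- inverse t) * inverse t ^ (m + 1))) (at t)"
      by (rule DERIV_cong[OF DERIV_mult[OF e p]]) (simp add: algebra_simps)
    then show ?thesis
      using 1 has_field_derivative_transform_within_open[of _ _ t "{0<..}" "flat_exp m"]
      by (simp add: flat_exp_def)
  next
    case 2
    then show ?thesis
      using has_field_derivative_transform_within_open[OF DERIV_const[of 0 "at t"], of "{..<0}" "flat_exp m"]
      by (simp add: flat_exp_def)
  next
    case 3
    \<comment> \<open>At 0 the difference quotient of \<open>flat_exp m\<close> is
      \<open>flat_exp (Suc m)\<close> itself, whose limit is already known.\<close>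
    have "((\<lambda>h. (flat_exp m h - flat_exp m 0) / h) \<longlongrightarrow> 0) (at 0)"
    proof (rule Lim_transform_eventually[OF flat_exp_tendsto_0[of "Suc m"]])
      show "eventually (\<lambda>h. flat_exp (Suc m) h = (flat_exp m h - flat_exp m 0) / h) (at 0)"
        by (auto simp: eventually_at_filter flat_exp_def field_simps)
    qed
    then show ?thesis using 3 by (simp add: DERIV_def flat_exp_def)
  qed
qed

lemma flat_exp_Ck: "Ck_on k UNIV (flat_exp m)"
proof (induction k arbitrary: m)
  case 0
  then show ?case
    using flat_exp_deriv DERIV_isCont continuous_at_imp_continuous_on by (metis Ck_on.simps(1))
next
  case (Suc k)
  show ?case
  proof (rule Ck_on_derivI[OF open_UNIV flat_exp_deriv[unfolded has_field_derivative_def]])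
    fix e :: real assume "e \<in> Basis"
    then have "e = 1" by simp
    moreover have "Ck_on k UNIV (\<lambda>t. flat_exp (m + 2) t + (- real m) *\<^sub>R flat_exp (m + 1) t)"
      by (intro Ck_on_add Ck_on_scaleR Ck_on_const Suc open_UNIV)
    ultimately show "Ck_on k UNIV (\<lambda>t. (flat_exp (m + 2) t - real m * flat_exp (m + 1) t) * e)"
      by simp
  qed
qed

lemma Ck_on_identity: "open S \<Longrightarrow> Ck_on k S (\<lambda>x. x)"
proof (cases k)
  case (Suc j)
  assume "open S"
  then show ?thesis
    unfolding Suc by (intro Ck_on_derivI[where f'="\<lambda>_ e. e"]) (auto intro: Ck_on_const)
qed auto

lemma smooth_bump_exists:
  fixes x0 :: "'a::euclidean_space"
  assumes "e > 0"
  obtains \<psi> :: "'a \<Rightarrow> real" where "\<And>k. Ck_on k UNIV \<psi>" "\<psi> x0 = 1"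
    "\<And>x. x \<notin> ball x0 e \<Longrightarrow> \<psi> x = 0"
proof
  \<comment> \<open>\<open>q\<close> is positive exactly on the ball. The squared distance is a
    polynomial in the coordinates, hence smooth at the centre as well; the factor in \<psi>
    normalises the value there, where \<open>q\<close> is e^2.\<close>
  define q where "q x = e\<^sup>2 - (dist x x0)\<^sup>2" for x :: 'a
  define \<psi> where "\<psi> x = inverse (flat_exp 0 (e\<^sup>2)) *\<^sub>R flat_exp 0 (q x)" for x :: 'a
  have q: "q = (\<lambda>x. e\<^sup>2 + (- 1) *\<^sub>R (\<Sum>i\<in>Basis. (x \<bullet> i + - (x0 \<bullet> i)) *\<^sub>R (x \<bullet> i + - (x0 \<bullet> i))))"
    unfolding q_def fun_eq_iff dist_norm power2_norm_eq_inner
    by (subst euclidean_inner) (simp add: inner_diff_left)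
  have "Ck_on k UNIV q" for k
    unfolding q
    by (intro Ck_on_add Ck_on_sum Ck_on_scaleR Ck_on_const
        Ck_on_bounded_linear[OF bounded_linear_inner_left] Ck_on_identity open_UNIV)
  then show "Ck_on k UNIV \<psi>" for k
    unfolding \<psi>_def
    by (intro Ck_on_scaleR Ck_on_const Ck_on_compose[OF open_UNIV _ _ flat_exp_Ck] open_UNIV) auto
  show "\<psi> x0 = 1" using assms by (simp add: \<psi>_def q_def flat_exp_def)
  fix x assume "x \<notin> ball x0 e"
  then have "q x \<le> 0" using assms by (auto simp: q_def dist_commute power_mono)
  then show "\<psi> x = 0" by (simp add: \<psi>_def flat_exp_def)
qed

section \<open>Traces\<close>

lemma linear_map_on_combination:
  assumes "subspace V" "linear_map_on V h" "finite B" "B \<subseteq> V"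
  shows "h (\<Sum>b\<in>B. c b *\<^sub>R b) = (\<Sum>b\<in>B. c b *\<^sub>R h b)"
  using assms(3,4)
proof (induction B rule: finite_induct)
  case empty
  have "h (0 *\<^sub>R 0) = 0 *\<^sub>R h 0"
    using assms(1,2) subspace_0 unfolding linear_map_on_def by blast
  then show ?case by simp
next
  case (insert b B)
  have "(\<Sum>b\<in>B. c b *\<^sub>R b) \<in> V" "c b *\<^sub>R b \<in> V" "b \<in> V"
    using insert.prems assms(1) by (auto intro!: subspace_sum subspace_scale)
  then have "h (c b *\<^sub>R b + (\<Sum>b\<in>B. c b *\<^sub>R b)) = c b *\<^sub>R h b + h (\<Sum>b\<in>B. c b *\<^sub>R b)"
    using assms(2) by (simp add: linear_map_on_def)
  then show ?case using insert by simp
qed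

text \<open>The diagonal entry at \<open>b\<close> is h(b) u_b - 1, and the sum of h(b) u_b is h(u)
  by linearity. \<open>B0\<close> guarantees that the basis chosen inside \<open>trace_on\<close>
  exists, and fixes its cardinality.\<close>

lemma trace_on_minus_id_plus_rank_one:
  assumes "independent B0" "finite B0" "span B0 = V"
    and h: "linear_map_on V h" and u: "u \<in> V"
    and F: "\<And>v. v \<in> V \<Longrightarrow> F v = h v *\<^sub>R u - v"
  shows "trace_on V F = h u - real (card B0)"
proof -
  define B where "B = (SOME B. independent B \<and> span B = V)"
  have B: "independent B" "span B = V"
    using someI[of "\<lambda>B. independent B \<and> span B = V" B0] assms(1,3) by (auto simp: B_def)
  have fin: "finite B"
    using independent_span_bound[OF assms(2) B(1)] span_superset[of B] B(2) assms(3) by auto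
  have card: "card B = card B0"
    by (metis B assms(1,3) dim_eq_card)
  have BV: "B \<subseteq> V" using span_superset[of B] B(2) by simp
  have "representation B (F b) b = h b * representation B u b - 1" if "b \<in> B" for b
  proof -
    have "b \<in> span B" "u \<in> span B" using that BV u B(2) by auto
    then have "representation B (h b *\<^sub>R u - b) b = h b * representation B u b - 1"
      using that B(1)
      by (simp add: real_vector.representation_diff real_vector.representation_scale
          real_vector.representation_basis span_scale)
    then show ?thesis using F that BV by (metis subsetD)
  qed
  then have "trace_on V F = (\<Sum>b\<in>B. h b * representation B u b) - real (card B0)"
    by (simp add: trace_on_def B_def[symmetric] sum_subtractf card)
  also have "(\<Sum>b\<in>B. h b * representation B u b) = h (\<Sum>b\<in>B. representation B u b *\<^sub>R b)"
    using linear_map_on_combination[OF _ h fin BV, of "representation B u"] B(2) subspace_span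
    by (metis (no_types, lifting) mult.commute real_scaleR_def sum.cong)
  also have "(\<Sum>b\<in>B. representation B u b *\<^sub>R b) = u"
    by (rule real_vector.sum_representation_eq) (use B fin u in auto)
  finally show ?thesis .
qed

section \<open>Charts and tangent spaces\<close>

lemma chart_inj: "is_chart T c \<Longrightarrow> inj_on (coord c) (dom_of c)"
  unfolding is_chart_def
  by (metis homeomorphic_imp_injective_map openin_subset topspace_subtopology_subset)

lemma coord_inv_coord: "is_chart T c \<Longrightarrow> p \<in> dom_of c \<Longrightarrow> coord_inv c (coord c p) = p"
  by (simp add: coord_inv_def chart_inj)

lemma open_coord_image:
  assumes c: "is_chart T c" and W: "openin T W" "W \<subseteq> dom_of c"
  shows "open (coord c ` W)"
proof -
  have "open_map (subtopology T (dom_of c)) (top_of_set (coord c ` dom_of c)) (coord c)"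
    using c homeomorphic_imp_open_map by (auto simp: is_chart_def)
  moreover have "openin (subtopology T (dom_of c)) W"
    using W by (metis inf.absorb_iff1 openin_subtopology)
  ultimately have "openin (top_of_set (coord c ` dom_of c)) (coord c ` W)"
    by (auto simp: open_map_def)
  then show ?thesis using c openin_open_trans by (auto simp: is_chart_def)
qed

text \<open>By injectivity \<open>inv_into\<close> agrees on the chart image with the inverse that
  the homeomorphism supplies. This later makes the preimage of a closed ball compact.\<close>

lemma continuous_map_coord_inv:
  assumes c: "is_chart T c"
  shows "continuous_map (top_of_set (coord c ` dom_of c)) T (coord_inv c)"
proof -
  obtain h where h: "homeomorphic_maps (subtopology T (dom_of c))
      (top_of_set (coord c ` dom_of c)) (coord c) h"
    using c by (auto simp: is_chart_def homeomorphic_map_maps)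
  have top: "topspace (subtopology T (dom_of c)) = dom_of c"
    using c by (auto simp: is_chart_def dest: openin_subset)
  have "continuous_map (top_of_set (coord c ` dom_of c)) T h"
    using h by (auto simp: homeomorphic_maps_def continuous_map_in_subtopology)
  moreover have "h x = coord_inv c x" if "x \<in> topspace (top_of_set (coord c ` dom_of c))" for x
    using that h top coord_inv_coord[OF c] by (auto simp: homeomorphic_maps_def)
  ultimately show ?thesis by (rule continuous_map_eq)
qed

lemma smooth_manifold_chart: "smooth_manifold T A \<Longrightarrow> c \<in> A \<Longrightarrow> is_chart T c"
  by (simp add: smooth_manifold_def)

lemma openin_dom: "smooth_manifold T A \<Longrightarrow> c \<in> A \<Longrightarrow> openin T (dom_of c)"
  using smooth_manifold_chart[of T A c] is_chart_def[of T c] by blast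

lemma transition_Ck:
  assumes "smooth_manifold T A" "c \<in> A" "d \<in> A"
  shows "Ck_on k (coord c ` (dom_of c \<inter> dom_of d)) (coord d \<circ> coord_inv c)"
  using assms by (auto simp: smooth_manifold_def smooth_on_def)

lemma open_overlap:
  assumes "smooth_manifold T A" "c \<in> A" "d \<in> A"
  shows "open (coord c ` (dom_of c \<inter> dom_of d))"
  using assms by (intro open_coord_image[of T]) (auto intro: smooth_manifold_chart openin_dom)

lemma transition_has_derivative:
  assumes "smooth_manifold T A" "c \<in> charts_at A p" "d \<in> charts_at A p"
  shows "((coord d \<circ> coord_inv c) has_derivative
      frechet_derivative (coord d \<circ> coord_inv c) (at (coord c p))) (at (coord c p))"
  using assms by (intro Ck_on_has_derivative[OF transition_Ck]) (auto simp: charts_at_def)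

lemma transition_derivative_refl:
  assumes A: "smooth_manifold T A" and c: "c \<in> charts_at A p"
  shows "frechet_derivative (coord c \<circ> coord_inv c) (at (coord c p)) v = v"
proof -
  have c': "c \<in> A" "p \<in> dom_of c" "is_chart T c"
    using c smooth_manifold_chart[OF A, of c] by (simp_all add: charts_at_def)
  have "((coord c \<circ> coord_inv c) has_derivative (\<lambda>v. v)) (at (coord c p))"
    by (rule has_derivative_transform_within_open[OF has_derivative_ident
          open_overlap[OF A c'(1) c'(1)]])
       (use c' coord_inv_coord[OF c'(3)] in auto)
  from frechet_derivative_at[OF this] show ?thesis by metis
qed

text \<open>The cocycle identity for Jacobians: on the triple overlap the passage through
  \<open>d\<close> cancels, and the chain rule gives the rest.\<close>

lemma transition_derivative_trans:
  assumes A: "smooth_manifold T A"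
    and c: "c \<in> charts_at A p" and d: "d \<in> charts_at A p" and e: "e \<in> charts_at A p"
  shows "frechet_derivative (coord e \<circ> coord_inv c) (at (coord c p)) v =
    frechet_derivative (coord e \<circ> coord_inv d) (at (coord d p))
      (frechet_derivative (coord d \<circ> coord_inv c) (at (coord c p)) v)"
proof -
  have ch: "is_chart T c" "is_chart T d" "p \<in> dom_of c" "p \<in> dom_of d" "p \<in> dom_of e"
    using c d e smooth_manifold_chart[OF A, of c] smooth_manifold_chart[OF A, of d]
    by (simp_all add: charts_at_def)
  let ?N = "coord c ` (dom_of c \<inter> dom_of d \<inter> dom_of e)"
  have "open ?N"
    using A c d e ch by (intro open_coord_image[of T] openin_Int) (auto simp: charts_at_def intro: openin_dom)
  have pd: "(coord d \<circ> coord_inv c) (coord c p) = coord d p"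
    using ch by (simp add: coord_inv_coord)
  have "((\<lambda>x. (coord e \<circ> coord_inv d) ((coord d \<circ> coord_inv c) x)) has_derivative
      (\<lambda>v. frechet_derivative (coord e \<circ> coord_inv d) (at (coord d p))
      (frechet_derivative (coord d \<circ> coord_inv c) (at (coord c p)) v))) (at (coord c p))"
    by (rule has_derivative_compose[OF transition_has_derivative[OF A c d]])
       (use transition_has_derivative[OF A d e] in \<open>unfold pd\<close>)
  then have "((coord e \<circ> coord_inv c) has_derivative
      (\<lambda>v. frechet_derivative (coord e \<circ> coord_inv d) (at (coord d p))
      (frechet_derivative (coord d \<circ> coord_inv c) (at (coord c p)) v))) (at (coord c p))"
    by (rule has_derivative_transform_within_open[OF _ \<open>open ?N\<close>])
       (use ch in \<open>auto simp: coord_inv_coord\<close>)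
  from frechet_derivative_at[OF this] show ?thesis by metis
qed

text \<open>The tangent vector with column \<open>v\<close> in the chart \<open>c\<close>. It
  identifies \<open>real ^ 'n\<close> with the tangent space, and evaluation at \<open>c\<close> is
  the inverse.\<close>

definition tangent_lift ::
  "('m, 'n::finite) chart set \<Rightarrow> ('m, 'n) chart \<Rightarrow> 'm \<Rightarrow> real ^ 'n \<Rightarrow> ('m, 'n) tangent" where
  "tangent_lift A c p v = (\<lambda>d. if d \<in> charts_at A p
     then frechet_derivative (coord d \<circ> coord_inv c) (at (coord c p)) v else 0)"

lemma tangent_lift_in_tangent_space:
  assumes "smooth_manifold T A" "c \<in> charts_at A p"
  shows "tangent_lift A c p v \<in> tangent_space A p"
  unfolding tangent_space_def mem_Collect_eq
proof (intro conjI ballI allI impI)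
  fix d e assume "d \<in> charts_at A p" "e \<in> charts_at A p"
  then show "tangent_lift A c p v e =
      frechet_derivative (coord e \<circ> coord_inv d) (at (coord d p)) (tangent_lift A c p v d)"
    unfolding tangent_lift_def by (simp only: if_True transition_derivative_trans[OF assms, of d e v])
qed (simp add: tangent_lift_def)

lemma tangent_lift_same:
  assumes "smooth_manifold T A" "c \<in> charts_at A p"
  shows "tangent_lift A c p v c = v"
  using transition_derivative_refl[OF assms] assms(2) by (simp add: tangent_lift_def)

lemma tangent_lift_component:
  assumes "c \<in> charts_at A p" "w \<in> tangent_space A p"
  shows "tangent_lift A c p (w c) = w"
proof
  fix d
  have "w d = frechet_derivative (coord d \<circ> coord_inv c) (at (coord c p)) (w c)"
    if "d \<in> charts_at A p" using assms that unfolding tangent_space_def by blast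
  moreover have "w d = 0" if "d \<notin> charts_at A p"
    using assms that unfolding tangent_space_def by blast
  ultimately show "tangent_lift A c p (w c) d = w d"
    by (simp add: tangent_lift_def)
qed

lemma linear_tangent_lift:
  assumes "smooth_manifold T A" "c \<in> charts_at A p"
  shows "linear (tangent_lift A c p)"
proof -
  have "linear (frechet_derivative (coord d \<circ> coord_inv c) (at (coord c p)))"
    if "d \<in> charts_at A p" for d
    by (rule bounded_linear.linear[OF has_derivative_bounded_linear[OF
            transition_has_derivative[OF assms that]]])
  then show ?thesis
    by (intro linearI)
       (auto simp: fun_eq_iff tangent_lift_def plus_fun_apply scaleR_fun_def linear_add linear_scale)
qed

lemma tangent_space_eq_range:
  assumes "smooth_manifold T A" "c \<in> charts_at A p"
  shows "tangent_space A p = range (tangent_lift A c p)"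
  using tangent_lift_in_tangent_space[OF assms] tangent_lift_component[OF assms(2)]
  by (auto, metis rangeI)

lemma subspace_tangent_space:
  assumes "smooth_manifold T A" "c \<in> charts_at A p"
  shows "subspace (tangent_space A p)"
  using linear_tangent_lift[OF assms]
  by (simp add: tangent_space_eq_range[OF assms] linear_subspace_image)

text \<open>The basis consists of the coordinate vectors of one chart around
  \<open>p\<close>.\<close>

lemma tangent_space_basis:
  fixes A :: "('m, 'n::finite) chart set"
  assumes "smooth_manifold T A" "p \<in> points A"
  obtains B where "independent B" "finite B" "card B = CARD('n)" "span B = tangent_space A p"
proof -
  obtain c where c: "c \<in> charts_at A p" using assms(2) by (auto simp: points_def charts_at_def)
  note lin = linear_tangent_lift[OF assms(1) c]
  have inj: "inj (tangent_lift A c p)"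
    by (metis assms(1) c injI tangent_lift_same)
  show thesis
  proof
    show "independent (tangent_lift A c p ` Basis)"
      by (rule linear_independent_injective_image[OF lin independent_Basis inj_on_subset[OF inj subset_UNIV]])
    show "finite (tangent_lift A c p ` Basis)" by simp
    show "card (tangent_lift A c p ` Basis) = CARD('n)"
      using inj by (simp add: card_image inj_on_subset)
    show "span (tangent_lift A c p ` Basis) = tangent_space A p"
      by (simp add: linear_span_image[OF lin] tangent_space_eq_range[OF assms(1) c])
  qed
qed

section \<open>Extending tangent vectors to vector fields\<close>

lemma vector_field_through:
  fixes A :: "('m, 'n::finite) chart set"
  assumes A: "smooth_manifold T A" and p: "p \<in> points A" and v: "v \<in> tangent_space A p"
  shows "\<exists>X\<in>vector_fields A. X p = v"
proof -
  obtain c where c: "c \<in> A" "p \<in> dom_of c" using p by (auto simp: points_def)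
  have chart: "is_chart T c" using A c smooth_manifold_chart by blast
  have "open (coord c ` dom_of c)" using chart by (simp add: is_chart_def)
  then obtain e where e: "e > 0" "cball (coord c p) e \<subseteq> coord c ` dom_of c"
    using c(2) open_contains_cball by (metis imageI)
  obtain \<psi> :: "real ^ 'n \<Rightarrow> real" where \<psi>: "\<And>k. Ck_on k UNIV \<psi>" "\<psi> (coord c p) = 1"
    "\<And>x. x \<notin> ball (coord c p) e \<Longrightarrow> \<psi> x = 0"
    using smooth_bump_exists[OF e(1)] by metis
  \<comment> \<open>The closed ball is compact, so \<open>K\<close> is compact and, in a Hausdorff
    space, closed. The complement of \<open>K\<close> is thus an open set on which the field
    vanishes.\<close>
  define K where "K = coord_inv c ` cball (coord c p) e"
  have "compactin (top_of_set (coord c ` dom_of c)) (cball (coord c p) e)"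
    using e(2) by (simp add: compactin_subtopology)
  then have "compactin T K"
    unfolding K_def using continuous_map_coord_inv[OF chart] image_compactin by blast
  then have K: "closedin T K"
    using A compactin_imp_closedin by (auto simp: smooth_manifold_def)
  have Kc: "K \<subseteq> dom_of c"
    using e(2) coord_inv_coord[OF chart] by (auto simp: K_def)
  have \<psi>0: "\<psi> (coord c q) = 0" if "q \<in> dom_of c" "q \<notin> K" for q
  proof (rule \<psi>(3))
    show "coord c q \<notin> ball (coord c p) e"
      using that coord_inv_coord[OF chart that(1)] ball_subset_cball
      unfolding K_def by (metis imageI subsetD)
  qed
  \<comment> \<open>The field with constant components \<open>v c\<close> in the chart
    \<open>c\<close>, cut off by the bump function.\<close>
  define X where "X q = (if q \<in> dom_of c then \<psi> (coord c q) *\<^sub>R tangent_lift A c q (v c) else 0)" for q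
  have "X q \<in> tangent_space A q" for q
  proof (cases "q \<in> dom_of c")
    case True
    then have "c \<in> charts_at A q" using c by (simp add: charts_at_def)
    then show ?thesis
      using True subspace_scale[OF subspace_tangent_space[OF A] tangent_lift_in_tangent_space[OF A]]
      by (simp add: X_def)
  next
    case False
    \<comment> \<open>Here \<open>q\<close> may lie outside the manifold, where no chart is
      available for \<open>subspace_tangent_space\<close>; the zero vector is checked directly by
      linearity of the Jacobians.\<close>
    have "frechet_derivative (coord d' \<circ> coord_inv d) (at (coord d q)) 0 = 0"
      if "d \<in> charts_at A q" "d' \<in> charts_at A q" for d d'
      by (rule linear_0[OF bounded_linear.linear[OF has_derivative_bounded_linear[OF
              transition_has_derivative[OF A that]]]])
    with False show ?thesis by (simp add: X_def tangent_space_def zero_fun_apply)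
  qed
  moreover have "Ck_on k (coord d ` dom_of d) (\<lambda>x. X (coord_inv d x) d)" if d: "d \<in> A" for d k
  proof (rule Ck_on_local)
    have chartd: "is_chart T d" using A d smooth_manifold_chart by blast
    fix x assume "x \<in> coord d ` dom_of d"
    then obtain q where q: "q \<in> dom_of d" "x = coord d q" by auto
    show "\<exists>N. open N \<and> x \<in> N \<and> Ck_on k N (\<lambda>x. X (coord_inv d x) d)"
    \<comment> \<open>As \<open>K\<close> lies in \<open>dom_of c\<close>, the domain of
      \<open>c\<close> and the complement of \<open>K\<close> cover everything.\<close>
    proof (cases "q \<in> dom_of c")
      case True
      \<comment> \<open>In the chart \<open>d\<close> the field reads \<psi>(t x) J(t x): pass to
        \<open>c\<close> by \<open>?t\<close>, then push \<open>v c\<close> back by the Jacobian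
        \<open>?J\<close>.\<close>
      let ?N = "coord d ` (dom_of d \<inter> dom_of c)" and ?t = "coord c \<circ> coord_inv d"
      let ?J = "\<lambda>y. frechet_derivative (coord d \<circ> coord_inv c) (at y) (v c)"
      have N: "open ?N" by (rule open_overlap[OF A d c(1)])
      have t: "Ck_on k ?N ?t" by (rule transition_Ck[OF A d c(1)])
      have "Ck_on k ?N (\<lambda>x. \<psi> (?t x) *\<^sub>R ?J (?t x))"
      proof (rule Ck_on_scaleR[OF N])
        show "Ck_on k ?N (\<lambda>x. \<psi> (?t x))"
          by (rule Ck_on_compose[OF N _ t \<psi>(1)]) simp
        show "Ck_on k ?N (\<lambda>x. ?J (?t x))"
        proof (rule Ck_on_compose[OF N _ t])
          show "?t ` ?N \<subseteq> coord c ` (dom_of c \<inter> dom_of d)"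
            using coord_inv_coord[OF chartd] by auto
          show "Ck_on k (coord c ` (dom_of c \<inter> dom_of d)) ?J"
            by (rule Ck_on_frechet_derivative[OF open_overlap[OF A c(1) d] transition_Ck[OF A c(1) d]])
        qed
      qed
      moreover have "\<psi> (?t y) *\<^sub>R ?J (?t y) = X (coord_inv d y) d" if "y \<in> ?N" for y
        using that coord_inv_coord[OF chartd] d
        by (auto simp: X_def tangent_lift_def scaleR_fun_def charts_at_def)
      ultimately have "Ck_on k ?N (\<lambda>x. X (coord_inv d x) d)"
        by (rule Ck_on_cong[OF N, rotated])
      then show ?thesis using N q True by blast
    next
      case False
      let ?N = "coord d ` (dom_of d - K)"
      have N: "open ?N"
        by (intro open_coord_image[OF chartd] openin_diff K openin_dom[OF A d]) auto
      have "Ck_on k ?N (\<lambda>x. X (coord_inv d x) d)"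
        by (rule Ck_on_cong[OF N _ Ck_on_const[OF N, of _ 0]])
           (use coord_inv_coord[OF chartd] \<psi>0 in \<open>auto simp: X_def scaleR_fun_def zero_fun_apply\<close>)
      then show ?thesis using N q False Kc by blast
    qed
  qed
  ultimately have "X \<in> vector_fields A"
    by (simp add: vector_fields_def smooth_on_def)
  moreover have "X p = v"
    using c v \<psi>(2) tangent_lift_component[of c A p v] by (simp add: X_def charts_at_def)
  ultimately show ?thesis by blast
qed

lemma extension:
  assumes "smooth_manifold T A" "p \<in> points A" "v \<in> tangent_space A p"
  shows "extension A p v \<in> vector_fields A" "extension A p v p = v"
  using someI_ex[of "\<lambda>X. X \<in> vector_fields A \<and> X p = v"] vector_field_through[OF assms]
  by (auto simp: extension_def)

section \<open>Para-Sasakian manifolds with vanishing D-concircular tensor\<close>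

lemma const_smooth_function:
  fixes A :: "('m, 'n::finite) chart set"
  assumes "smooth_manifold T A"
  shows "(\<lambda>_. k) \<in> smooth_functions A"
proof -
  have "Ck_on j (coord c ` dom_of c) (\<lambda>_. k)" if "c \<in> A" for c :: "('m, 'n) chart" and j
    using smooth_manifold_chart[OF assms that] by (intro Ck_on_const) (simp add: is_chart_def)
  then show ?thesis by (simp add: smooth_functions_def smooth_on_def o_def)
qed

text \<open>The scalar curvature cancels, and 2(n-1) - n(n-1) = -(n-1)(n-2).\<close>

lemma coeff_sum:
  assumes "n > (2::real)"
  shows "coeff_a n r + coeff_b n r = - 1"
proof -
  have "(n - 1) * (n - 2) \<noteq> 0" using assms by simp
  then show ?thesis
    by (simp add: coeff_a_def coeff_b_def add_divide_distrib[symmetric] divide_eq_eq algebra_simps)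
qed

text \<open>\<open>r\<close> is tied to the scalar curvature at \<open>p\<close> only, so it can be
  the global constant or simply the value at \<open>p\<close>.\<close>

lemma para_sasakian_curvature:
  fixes A :: "('m, 'n::finite) chart set"
  assumes "para_sasakian T A \<phi> \<xi> \<eta> g D"
    and "D_concircular A g D \<xi> \<eta> X Y Z p = 0"
    and "scalar_curvature A g D p = r"
  shows "curvature A D X Y Z p = quasi_constant_tensor g \<xi> \<eta>
    (\<lambda>_. coeff_a (real CARD('n)) r) (\<lambda>_. coeff_b (real CARD('n)) r) X Y Z p"
  using assms(2,3) by (simp add: D_concircular_def quasi_constant_tensor_def)

text \<open>The squared length of \<phi>\<xi> is g(\<xi>,\<xi>) - \<eta>(\<xi>)^2 = 1 - 1, and g is
  positive definite.\<close>

lemma para_sasakian_phi_xi: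
  assumes ps: "para_sasakian T A \<phi> \<xi> \<eta> g D" and p: "p \<in> points A"
  shows "\<phi> p (\<xi> p) = 0"
proof (rule ccontr)
  assume "\<phi> p (\<xi> p) \<noteq> 0"
  have \<xi>: "\<xi> \<in> vector_fields A" using ps by (simp add: para_sasakian_def)
  have "(\<lambda>p. \<phi> p (\<xi> p)) \<in> vector_fields A"
    using ps \<xi> by (simp add: para_sasakian_def tensor_1_1_def)
  then have "\<phi> p (\<xi> p) \<in> tangent_space A p" by (simp add: vector_fields_def)
  moreover have "riemannian_metric A g"
    using ps by (simp add: para_sasakian_def riemannian_manifold_def)
  ultimately have "g p (\<phi> p (\<xi> p)) (\<phi> p (\<xi> p)) > 0"
    using p \<open>\<phi> p (\<xi> p) \<noteq> 0\<close> unfolding riemannian_metric_def by blast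
  moreover have "g p (\<phi> p (\<xi> p)) (\<phi> p (\<xi> p)) = g p (\<xi> p) (\<xi> p) - \<eta> p (\<xi> p) * \<eta> p (\<xi> p)"
    "\<eta> p (\<xi> p) = g p (\<xi> p) (\<xi> p)" "\<eta> p (\<xi> p) = 1"
    using ps p \<xi> unfolding para_sasakian_def by blast+
  ultimately show False by simp
qed

text \<open>Metric compatibility turns the derivative of g(\<xi>,\<xi>) along \<xi> into terms with
  \<open>D \<xi> \<xi>\<close>; the other two terms contain [\<xi>,\<xi>] = 0.\<close>

lemma para_sasakian_lie_deriv_metric:
  assumes ps: "para_sasakian T A \<phi> \<xi> \<eta> g D" and p: "p \<in> points A"
  shows "lie_deriv_metric A g \<xi> \<xi> \<xi> p = 0"
proof -
  have \<xi>: "\<xi> \<in> vector_fields A" using ps by (simp add: para_sasakian_def)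
  then have \<xi>p: "\<xi> p \<in> tangent_space A p" by (simp add: vector_fields_def)
  have M: "smooth_manifold T A" and met: "riemannian_metric A g" and lc: "levi_civita A g D"
    using ps by (simp_all add: para_sasakian_def riemannian_manifold_def)
  obtain c where "c \<in> charts_at A p" using p by (auto simp: points_def charts_at_def)
  \<comment> \<open>\<open>g p\<close> is bilinear on the tangent space only, so g(\<xi>,0) = 0
    requires 0 to be a member.\<close>
  then have 0: "0 \<in> tangent_space A p" using subspace_0[OF subspace_tangent_space[OF M]] by blast
  have "linear_map_on (tangent_space A p) (g p (\<xi> p))"
    using met p \<xi>p unfolding riemannian_metric_def by blast
  then have "g p (\<xi> p) (0 *\<^sub>R 0) = 0 *\<^sub>R g p (\<xi> p) 0"
    using 0 unfolding linear_map_on_def by blast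
  then have g0: "g p (\<xi> p) 0 = 0" by simp
  have g0': "g p 0 (\<xi> p) = 0"
    using met p \<xi>p 0 g0 unfolding riemannian_metric_def by metis
  have "D \<xi> \<xi> p = \<phi> p (\<xi> p)" using ps \<xi> p unfolding para_sasakian_def by blast
  then have "D \<xi> \<xi> p = 0" using para_sasakian_phi_xi[OF ps p] by simp
  moreover have "dir_deriv A \<xi> (\<lambda>q. g q (\<xi> q) (\<xi> q)) p =
      g p (D \<xi> \<xi> p) (\<xi> p) + g p (\<xi> p) (D \<xi> \<xi> p)"
    using lc \<xi> p unfolding levi_civita_def by blast
  moreover have "bracket A \<xi> \<xi> p = 0" by (auto simp: bracket_def zero_fun_apply fun_eq_iff)
  ultimately show ?thesis by (simp add: lie_deriv_metric_def g0 g0')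
qed

lemma ricci_xi_xi:
  fixes A :: "('m, 'n::finite) chart set"
  assumes n: "CARD('n) > 2" and ps: "para_sasakian T A \<phi> \<xi> \<eta> g D" and p: "p \<in> points A"
    and dc: "\<forall>X\<in>vector_fields A. \<forall>Y\<in>vector_fields A. \<forall>Z\<in>vector_fields A.
           D_concircular A g D \<xi> \<eta> X Y Z p = 0"
  shows "ricci A D p (\<xi> p) (\<xi> p) = 1 - real CARD('n)"
proof -
  have \<xi>: "\<xi> \<in> vector_fields A" using ps by (simp add: para_sasakian_def)
  then have \<xi>p: "\<xi> p \<in> tangent_space A p" by (simp add: vector_fields_def)
  have M: "smooth_manifold T A" and met: "riemannian_metric A g"
    and \<eta>: "linear_map_on (tangent_space A p) (\<eta> p)"
    using ps by (simp_all add: para_sasakian_def riemannian_manifold_def one_form_def)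
  have \<eta>\<xi>: "\<eta> p (\<xi> p) = 1" using ps p unfolding para_sasakian_def by blast
  have g\<xi>: "\<eta> p (X p) = g p (X p) (\<xi> p)" if "X \<in> vector_fields A" for X
    using ps p that unfolding para_sasakian_def by blast
  let ?r = "scalar_curvature A g D p" and ?n = "real CARD('n)"
  let ?a = "coeff_a ?n ?r" and ?b = "coeff_b ?n ?r"
  have ab: "?a + ?b = - 1" using n by (intro coeff_sum) simp
  obtain B where B: "independent B" "finite B" "card B = CARD('n)" "span B = tangent_space A p"
    using tangent_space_basis[OF M p] by blast
  have "curvature_at A D p z (\<xi> p) (\<xi> p) = \<eta> p z *\<^sub>R \<xi> p - z" if z: "z \<in> tangent_space A p" for z
  proof -
    note Z = extension[OF M p z] and Y = extension[OF M p \<xi>p]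
    have gz: "g p z (\<xi> p) = \<eta> p z" and g1: "g p (\<xi> p) (\<xi> p) = 1"
      using g\<xi>[OF Z(1)] g\<xi>[OF \<xi>] Z(2) \<eta>\<xi> by simp_all
    \<comment> \<open>For Y = Z = \<xi> the b-term along \<xi> cancels, while the a-term and the
      other b-term both give a multiple of z - \<eta>(z)\<xi>.\<close>
    have "curvature_at A D p z (\<xi> p) (\<xi> p) =
        ?a *\<^sub>R (z - \<eta> p z *\<^sub>R \<xi> p) + ?b *\<^sub>R (z - \<eta> p z *\<^sub>R \<xi> p)"
      unfolding curvature_at_def
      by (subst para_sasakian_curvature[OF ps _ refl])
         (use dc Z Y in \<open>simp_all add: quasi_constant_tensor_def gz g1 \<eta>\<xi>\<close>)
    also have "\<dots> = (?a + ?b) *\<^sub>R (z - \<eta> p z *\<^sub>R \<xi> p)" by (simp only: scaleR_left_distrib)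
    finally show ?thesis by (simp add: ab)
  qed
  then have "ricci A D p (\<xi> p) (\<xi> p) = \<eta> p (\<xi> p) - real (card B)"
    unfolding ricci_def by (intro trace_on_minus_id_plus_rank_one[OF B(1,2,4) \<eta> \<xi>p])
  then show ?thesis by (simp add: \<eta>\<xi> B(3))
qed

theorem mainTheorem3:
  fixes T :: "'m topology"
    and A :: "('m, 'n::finite) chart set"
    and \<phi> :: "'m \<Rightarrow> ('m, 'n) tangent \<Rightarrow> ('m, 'n) tangent"
    and \<xi> :: "('m, 'n) field"
    and \<eta> :: "'m \<Rightarrow> ('m, 'n) tangent \<Rightarrow> real"
    and g :: "('m, 'n) metric"
    and D :: "('m, 'n) conn"
    and r :: real
  assumes "CARD('n) > 2"
    and "para_sasakian T A \<phi> \<xi> \<eta> g D"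
    and "\<forall>p\<in>points A. scalar_curvature A g D p = r"
    and "\<forall>X\<in>vector_fields A. \<forall>Y\<in>vector_fields A. \<forall>Z\<in>vector_fields A. \<forall>p\<in>points A.
           D_concircular A g D \<xi> \<eta> X Y Z p = 0"
  shows "quasi_constant_curvature T A g D \<xi>
           (\<lambda>p. (r + 2 * (real CARD('n) - 1)) / ((real CARD('n) - 1) * (real CARD('n) - 2)))
           (\<lambda>p. (- r - real CARD('n) * (real CARD('n) - 1)) /
                ((real CARD('n) - 1) * (real CARD('n) - 2)))
         \<and> (\<forall>lambda. ricci_soliton A g D \<xi> lambda \<longrightarrow> lambda > 0)"
proof -
  note ps = assms(2)
  have \<xi>: "\<xi> \<in> vector_fields A" and rm: "riemannian_manifold T A g D"
    using ps by (simp_all add: para_sasakian_def)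
  then have M: "smooth_manifold T A" by (simp add: riemannian_manifold_def)
  have \<eta>: "\<eta> p (X p) = g p (X p) (\<xi> p)" if "X \<in> vector_fields A" "p \<in> points A" for X p
    using ps that unfolding para_sasakian_def by blast
  have \<eta>\<xi>: "\<eta> p (\<xi> p) = 1" if "p \<in> points A" for p
    using ps that unfolding para_sasakian_def by blast
  \<comment> \<open>The target condition uses the metric dual of \<xi> in place of \<eta>; the two
    agree on vector fields.\<close>
  have "curvature A D X Y Z p = quasi_constant_tensor g \<xi> (\<lambda>q v. g q v (\<xi> q))
      (\<lambda>_. coeff_a (real CARD('n)) r) (\<lambda>_. coeff_b (real CARD('n)) r) X Y Z p"
    if "X \<in> vector_fields A" "Y \<in> vector_fields A" "Z \<in> vector_fields A" "p \<in> points A" for X Y Z p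
    using para_sasakian_curvature[OF ps, of X Y Z p r] assms(3,4) that \<eta>
    by (simp add: quasi_constant_tensor_def)
  then have "quasi_constant_curvature T A g D \<xi>
      (\<lambda>_. coeff_a (real CARD('n)) r) (\<lambda>_. coeff_b (real CARD('n)) r)"
    using rm \<xi> const_smooth_function[OF M] \<eta>[OF \<xi>] \<eta>\<xi>
    by (simp add: quasi_constant_curvature_def)
  moreover have "l > 0" if sol: "ricci_soliton A g D \<xi> l" for l
  proof -
    \<comment> \<open>The manifold is nonempty, and the soliton equation at one point already
      determines the constant.\<close>
    obtain p where p: "p \<in> points A"
      using M unfolding smooth_manifold_def points_def by blast
    have "lie_deriv_metric A g \<xi> \<xi> \<xi> p + 2 * ricci A D p (\<xi> p) (\<xi> p)
        + 2 * l * g p (\<xi> p) (\<xi> p) = 0"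
      using sol \<xi> p unfolding ricci_soliton_def by blast
    moreover have "g p (\<xi> p) (\<xi> p) = 1" using \<eta>[OF \<xi> p] \<eta>\<xi>[OF p] by simp
    moreover have "ricci A D p (\<xi> p) (\<xi> p) = 1 - real CARD('n)"
      using assms(4) p by (intro ricci_xi_xi[OF assms(1) ps p]) blast
    ultimately have "l = real CARD('n) - 1"
      using para_sasakian_lie_deriv_metric[OF ps p] by simp
    then show ?thesis using assms(1) by simp
  qed
  ultimately show ?thesis by (auto simp: coeff_a_def coeff_b_def)
qed

end
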